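(* Let $f,g:\mathbb R\to\mathbb R$ be smooth $2\pi$-periodic functions satisfying the following two hypotheses. (C.1) $f$ and $g$ have no common zeros, and $g$ has exactly two zeros in any $2\pi$-period (half-open interval of length $2\pi$). (C.2) The function $u(t):=-\frac{f(t)}{g(t)}$ has the same strict monotonicity on all connected components of $\{t\in\mathbb R: g(t)\neq 0\}$; that is, either $u$ is strictly increasing on every such component, or $u$ is strictly decreasing on every such component. Then each non-zero limit cycle (i.e. each limit cycle in the region $x\neq 0$) of the equation $$\frac{dx}{dt}=g(t)x^3+f(t)x^2$$ has multiplicity at most two. Moreover, any non-hyperbolic non-zero limit cycle must be lower-stable and upper-unstable if $u$ is strictly increasing on the components of $\{g\ne0\}$, and lower-unstable and upper-stable if $u$ is strictly decreasing on the components of $\{g\neq 0\}$.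
   Context: A periodic solution of the equation is a solution $x(t)$ defined on $[t_0,t_0+2\pi]$ with $x(t_0+2\pi)=x(t_0)$ (hence extending to a $2\pi$-periodic solution on $\mathbb R$). A limit cycle is an isolated periodic solution (isolated among periodic solutions). Let $L$ be the Poincaré map, which sends an initial value $\rho$ at time $t_0$ to the value at time $t_0+2\pi$ of the corresponding solution. If $x(t)$ is a limit cycle with $x(t_0)=\rho_0$, its multiplicity is the order of $\rho_0$ as a zero of the displacement function $\rho\mapsto L(\rho)-\rho$. It is hyperbolic if $L'(\rho_0)\neq 1$ (multiplicity one), and non-hyperbolic otherwise. It is upper-stable (resp. upper-unstable) if $L(\rho)<\rho$ (resp. $L(\rho)>\rho$) for all $\rho>\rho_0$ sufficiently close to $\rho_0$. It is lower-stable (resp. lower-unstable) if $L(\rho)>\rho$ (resp. $L(\rho)<\rho$) for all $\rho<\rho_0$ sufficiently close to $\rho_0$. *)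

theory Defs
  imports "HOL-Analysis.Analysis"
begin

definition smooth :: "(real \<Rightarrow> real) \<Rightarrow> bool" where
  "smooth h \<longleftrightarrow> (\<forall>n t. (deriv ^^ n) h differentiable at t)"

text \<open>
  Throughout, \<open>F t x\<close> is the right-hand side of a scalar equation \<open>dx/dt = F t x\<close> that is
  \<open>2 * pi\<close>-periodic in \<open>t\<close>, and \<open>t0\<close> is the initial time. A solution is a total function of which
  only the values on \<open>{t0..t0 + 2 * pi}\<close> matter.
\<close>

definition solution :: "(real \<Rightarrow> real \<Rightarrow> real) \<Rightarrow> real \<Rightarrow> (real \<Rightarrow> real) \<Rightarrow> bool" where
  "solution F t0 x \<longleftrightarrow>
     (\<forall>t\<in>{t0..t0 + 2 * pi}. (x has_real_derivative F t (x t)) (at t within {t0..t0 + 2 * pi}))"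

definition periodic_solution :: "(real \<Rightarrow> real \<Rightarrow> real) \<Rightarrow> real \<Rightarrow> (real \<Rightarrow> real) \<Rightarrow> bool" where
  "periodic_solution F t0 x \<longleftrightarrow> solution F t0 x \<and> x (t0 + 2 * pi) = x t0"

text \<open>Isolation is meant with respect to the uniform distance on one period.\<close>

definition limit_cycle :: "(real \<Rightarrow> real \<Rightarrow> real) \<Rightarrow> real \<Rightarrow> (real \<Rightarrow> real) \<Rightarrow> bool" where
  "limit_cycle F t0 x \<longleftrightarrow> periodic_solution F t0 x \<and>
     (\<exists>\<epsilon>>0. \<forall>y. periodic_solution F t0 y \<and> (\<forall>t\<in>{t0..t0 + 2 * pi}. \<bar>y t - x t\<bar> < \<epsilon>) \<longrightarrow>
        (\<forall>t\<in>{t0..t0 + 2 * pi}. y t = x t))"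

text \<open>
  The value is meaningful only if the solution starting at \<open>\<rho>\<close> exists up to time \<open>t0 + 2 * pi\<close>
  (it is then unique when \<open>F\<close> is smooth). The set of such \<open>\<rho>\<close> is open, so it contains a
  neighbourhood of the initial value of every periodic solution; all notions below are local
  at such an initial value.
\<close>

definition poincare :: "(real \<Rightarrow> real \<Rightarrow> real) \<Rightarrow> real \<Rightarrow> real \<Rightarrow> real" where
  "poincare F t0 \<rho> = (THE v. \<exists>x. solution F t0 x \<and> x t0 = \<rho> \<and> x (t0 + 2 * pi) = v)"

text \<open>
  \<open>\<rho>\<close> is a zero of order exactly \<open>k\<close>. Differentiability is part of the definition because
  \<^const>\<open>deriv\<close> is unspecified where no derivative exists.
\<close>

definition has_zero_of_order :: "(real \<Rightarrow> real) \<Rightarrow> real \<Rightarrow> nat \<Rightarrow> bool" where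
  "has_zero_of_order d \<rho> k \<longleftrightarrow> k \<ge> 1 \<and>
     (\<forall>j<k. \<forall>\<^sub>F s in nhds \<rho>. (deriv ^^ j) d differentiable at s) \<and>
     (\<forall>j<k. (deriv ^^ j) d \<rho> = 0) \<and> (deriv ^^ k) d \<rho> \<noteq> 0"

definition has_multiplicity ::
  "(real \<Rightarrow> real \<Rightarrow> real) \<Rightarrow> real \<Rightarrow> (real \<Rightarrow> real) \<Rightarrow> nat \<Rightarrow> bool" where
  "has_multiplicity F t0 x k \<longleftrightarrow> has_zero_of_order (\<lambda>\<rho>. poincare F t0 \<rho> - \<rho>) (x t0) k"

definition hyperbolic :: "(real \<Rightarrow> real \<Rightarrow> real) \<Rightarrow> real \<Rightarrow> (real \<Rightarrow> real) \<Rightarrow> bool" where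
  "hyperbolic F t0 x \<longleftrightarrow> deriv (poincare F t0) (x t0) \<noteq> 1"

definition upper_stable :: "(real \<Rightarrow> real \<Rightarrow> real) \<Rightarrow> real \<Rightarrow> (real \<Rightarrow> real) \<Rightarrow> bool" where
  "upper_stable F t0 x \<longleftrightarrow> (\<forall>\<^sub>F \<rho> in at_right (x t0). poincare F t0 \<rho> < \<rho>)"

definition upper_unstable :: "(real \<Rightarrow> real \<Rightarrow> real) \<Rightarrow> real \<Rightarrow> (real \<Rightarrow> real) \<Rightarrow> bool" where
  "upper_unstable F t0 x \<longleftrightarrow> (\<forall>\<^sub>F \<rho> in at_right (x t0). poincare F t0 \<rho> > \<rho>)"

definition lower_stable :: "(real \<Rightarrow> real \<Rightarrow> real) \<Rightarrow> real \<Rightarrow> (real \<Rightarrow> real) \<Rightarrow> bool" where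
  "lower_stable F t0 x \<longleftrightarrow> (\<forall>\<^sub>F \<rho> in at_left (x t0). poincare F t0 \<rho> > \<rho>)"

definition lower_unstable :: "(real \<Rightarrow> real \<Rightarrow> real) \<Rightarrow> real \<Rightarrow> (real \<Rightarrow> real) \<Rightarrow> bool" where
  "lower_unstable F t0 x \<longleftrightarrow> (\<forall>\<^sub>F \<rho> in at_left (x t0). poincare F t0 \<rho> < \<rho>)"

end

theory Submission
  imports Defs
begin

text \<open>
  Along a solution \<open>x\<close> put \<open>e(t) = exp (\<integral> g x\<^sup>2)\<close>, the integral starting at \<open>t0\<close>. Two solutions \<open>y\<close>, \<open>z\<close>
  satisfy a linear equation \<open>(z - y)' = s(t) (z - y)\<close> with \<open>s\<close> a polynomial in \<open>y\<close> and \<open>z\<close>, so the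
  difference of two solutions is explicit (\<open>solution_difference\<close>). Nearby solutions exist by a
  contraction argument (\<open>nearby_solutions\<close>), and the Poincare map \<open>L\<close> is then twice differentiable
  with the usual variational formulas (\<open>poincare_twice_differentiable\<close>).

  On a closed orbit \<open>x \<noteq> 0\<close> with initial value \<open>x0\<close>, the first variation is \<open>x\<^sup>2 e / x0\<^sup>2\<close>, so that
  \<open>L' = e(t0 + 2 pi)\<close>. If the orbit is not hyperbolic then \<open>e\<close> is periodic too, and an integration
  by parts turns the second variation into \<open>x0\<^sup>2 L'' = 2 \<integral> g x\<^sup>3 e\<close> over one period.

  The heart of the matter is the sign of this integral. Since \<open>e' = g x\<^sup>2 e\<close>, it is the area
  integral of \<open>x de\<close> around the closed curve \<open>(e, x)\<close>. In the coordinates \<open>v = 1 / e\<close> and \<open>y = x / e\<close> the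
  equation says \<open>dy / dv = u\<close>. The two zeros \<open>z1\<close>, \<open>z2\<close> of \<open>g\<close> cut the curve into two arcs on each of which \<open>v\<close>
  is monotone, that is, into two graphs over the same \<open>v\<close>-interval with common end points. When \<open>u\<close>
  increases with time, the graph traversed with \<open>v\<close> decreasing is concave and the other one is
  convex, so the common chord separates them. In terms of \<open>t\<close>: with \<open>\<alpha>\<close>, \<open>\<beta>\<close> chosen such that
  \<open>h = (x - \<beta>) / e - \<alpha>\<close> vanishes at \<open>z1\<close> and \<open>z2\<close>, the functions \<open>h\<close> and \<open>g\<close> have the same sign
  (\<open>sign_between_zeros\<close>). As \<open>\<integral> g x\<^sup>2 e\<close> and \<open>\<integral> g x\<^sup>2 e\<^sup>2\<close> are integrals of derivatives of periodic
  functions, they vanish, and hence \<open>\<integral> g x\<^sup>3 e = \<integral> g x\<^sup>2 e\<^sup>2 h > 0\<close> (\<open>weighted_integral_sign\<close>).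
  For decreasing \<open>u\<close> the sign of \<open>h\<close>, and with it that of the integral, is reversed.
  Thus \<open>L'' \<noteq> 0\<close> with a known sign at every non-hyperbolic orbit, which gives the bound two on the
  multiplicity and the semi-stability.
\<close>

section \<open>Integrals depending on a parameter\<close>

lemma has_real_derivative_exp_integral:
  fixes h :: "real \<Rightarrow> real"
  assumes "continuous_on {a..b} h" "t \<in> {a..b}"
  shows "((\<lambda>t. exp (integral {a..t} h)) has_real_derivative exp (integral {a..t} h) * h t)
    (at t within {a..b})"
  using integral_has_real_derivative[OF assms] by (auto intro!: derivative_eq_intros)

text \<open>
  Separate continuity is not joint continuity. A Lipschitz bound in one variable that is uniform
  in the other repairs this.
\<close>

lemma continuous_on_Times_lipschitz:
  fixes H :: "real \<Rightarrow> real \<Rightarrow> real"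
  assumes cont: "\<And>t. t \<in> T \<Longrightarrow> continuous_on U (\<lambda>r. H r t)"
    and lip: "\<And>r s t. r \<in> U \<Longrightarrow> s \<in> T \<Longrightarrow> t \<in> T \<Longrightarrow> \<bar>H r s - H r t\<bar> \<le> M * \<bar>s - t\<bar>"
  shows "continuous_on (U \<times> T) (\<lambda>(r, t). H r t)"
  unfolding continuous_on_iff
proof (intro ballI allI impI)
  fix p and e :: real
  assume "p \<in> U \<times> T" and e: "0 < e"
  then obtain r t where p: "p = (r, t)" and rt: "r \<in> U" "t \<in> T" by auto
  obtain d where d: "d > 0" "\<And>q. q \<in> U \<Longrightarrow> dist q r < d \<Longrightarrow> \<bar>H q t - H r t\<bar> < e / 2"
    using cont[OF rt(2)] rt(1) e unfolding continuous_on_iff dist_real_def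
    by (meson half_gt_zero)
  define d' where "d' = min d (e / (2 * (\<bar>M\<bar> + 1)))"
  have "d' > 0" using d(1) e by (simp add: d'_def)
  moreover have "dist (H q s) (H r t) < e"
    if q: "q \<in> U" "s \<in> T" "dist (q, s) (r, t) < d'" for q s
  proof -
    have "dist q r < d'" "dist s t < d'"
      using q(3) dist_fst_le[of "(q, s)" "(r, t)"] dist_snd_le[of "(q, s)" "(r, t)"] by auto
    then have 1: "dist q r < d" and 2: "\<bar>s - t\<bar> < e / (2 * (\<bar>M\<bar> + 1))"
      by (auto simp: d'_def dist_real_def)
    have "\<bar>H q s - H q t\<bar> \<le> M * \<bar>s - t\<bar>" using lip q rt by blast
    also have "\<dots> \<le> (\<bar>M\<bar> + 1) * \<bar>s - t\<bar>" by (intro mult_right_mono) auto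
    also have "\<dots> \<le> e / 2" using 2 by (simp add: field_simps pos_less_divide_eq)
    finally show ?thesis using d(2)[OF q(1) 1] unfolding dist_real_def by linarith
  qed
  ultimately show "\<exists>d>0. \<forall>q\<in>U \<times> T. dist q p < d \<longrightarrow>
      dist (case q of (r, t) \<Rightarrow> H r t) (case p of (r, t) \<Rightarrow> H r t) < e"
    unfolding p by (auto intro!: exI[of _ d'])
qed

lemma abs_integral_diff_le:
  fixes h :: "real \<Rightarrow> real"
  assumes "continuous_on {a..b} h" "\<And>t. t \<in> {a..b} \<Longrightarrow> \<bar>h t\<bar> \<le> M"
    "s \<in> {a..b}" "t \<in> {a..b}"
  shows "\<bar>integral {a..s} h - integral {a..t} h\<bar> \<le> M * \<bar>s - t\<bar>"
proof -
  have *: "\<bar>integral {a..s} h - integral {a..t} h\<bar> \<le> M * \<bar>s - t\<bar>"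
    if st: "s \<in> {a..b}" "t \<in> {a..b}" "s \<le> t" for s t
  proof -
    have "integral {a..s} h + integral {s..t} h = integral {a..t} h"
      using st by (intro Henstock_Kurzweil_Integration.integral_combine integrable_continuous_real continuous_on_subset[OF assms(1)]) auto
    moreover have "norm (integral {s..t} h) \<le> M * (t - s)"
      using st assms(2) by (intro integral_bound continuous_on_subset[OF assms(1)]) auto
    ultimately show ?thesis using st by simp
  qed
  show ?thesis using *[of s t] *[of t s] assms(3,4) by (cases "s \<le> t") (auto simp: abs_minus_commute)
qed

text \<open>
  The bound on the integrand makes the integral Lipschitz in its upper limit, uniformly in the
  parameter.
\<close>

lemma continuous_on_integral_upto:
  fixes H :: "real \<Rightarrow> real \<Rightarrow> real"
  assumes cont: "continuous_on (U \<times> {a..b}) (\<lambda>(r, s). H r s)"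
    and bound: "\<And>r s. r \<in> U \<Longrightarrow> s \<in> {a..b} \<Longrightarrow> \<bar>H r s\<bar> \<le> M"
  shows "continuous_on (U \<times> {a..b}) (\<lambda>(r, t). integral {a..t} (H r))"
proof (rule continuous_on_Times_lipschitz)
  fix t assume "t \<in> {a..b}"
  then have "continuous_on (U \<times> cbox a t) (\<lambda>(r, s). H r s)"
    by (intro continuous_on_subset[OF cont]) auto
  from integral_continuous_on_param[OF this]
  show "continuous_on U (\<lambda>r. integral {a..t} (H r))" by simp
next
  fix r s t assume r: "r \<in> U" and "s \<in> {a..b}" "t \<in> {a..b}"
  moreover have "continuous_on {a..b} (H r)"
  proof -
    have "continuous_on {a..b} (\<lambda>s. (\<lambda>(r, s). H r s) (r, s))"
      by (rule continuous_on_compose2[OF cont]) (use r in \<open>auto intro!: continuous_intros\<close>)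
    then show ?thesis by simp
  qed
  ultimately show "\<bar>integral {a..s} (H r) - integral {a..t} (H r)\<bar> \<le> M * \<bar>s - t\<bar>"
    using bound by (intro abs_integral_diff_le) auto
qed

section \<open>A quadratic-cubic equation with small data\<close>

lemma quadratic_cubic_lipschitz:
  fixes v w :: real
  assumes "\<bar>v\<bar> \<le> \<eta>" "\<bar>w\<bar> \<le> \<eta>" "\<eta> \<le> 1" "\<bar>p\<bar> \<le> M" "\<bar>q\<bar> \<le> M"
  shows "\<bar>(p * v^2 + q * v^3) - (p * w^2 + q * w^3)\<bar> \<le> 5 * M * \<eta> * \<bar>v - w\<bar>"
proof -
  have \<eta>: "0 \<le> \<eta>" "0 \<le> M" using assms by auto
  have "\<bar>v + w\<bar> \<le> 2 * \<eta>" using assms by auto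
  moreover have "\<bar>v^2 + v * w + w^2\<bar> \<le> 3 * \<eta>"
  proof -
    have "\<bar>x * y\<bar> \<le> \<eta>" if "\<bar>x\<bar> \<le> \<eta>" "\<bar>y\<bar> \<le> \<eta>" for x y :: real
      using mult_mono[of "\<bar>x\<bar>" \<eta> "\<bar>y\<bar>" 1] that assms(3) \<eta> by (simp add: abs_mult)
    from this[of v v] this[of v w] this[of w w] assms show ?thesis
      unfolding power2_eq_square by linarith
  qed
  ultimately have "\<bar>p * (v + w) + q * (v^2 + v * w + w^2)\<bar> \<le> M * (2 * \<eta>) + M * (3 * \<eta>)"
    using assms \<eta>
    by (intro order_trans[OF abs_triangle_ineq] add_mono) (auto simp: abs_mult intro!: mult_mono)
  then have "\<bar>p * (v + w) + q * (v^2 + v * w + w^2)\<bar> * \<bar>v - w\<bar> \<le> 5 * M * \<eta> * \<bar>v - w\<bar>"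
    by (intro mult_right_mono) auto
  moreover have "(p * v^2 + q * v^3) - (p * w^2 + q * w^3)
      = (p * (v + w) + q * (v^2 + v * w + w^2)) * (v - w)"
    by (simp add: algebra_simps power2_eq_square power3_eq_cube)
  ultimately show ?thesis by (simp add: abs_mult)
qed

text \<open>
  The right-hand side has no linear term, so its Lipschitz constant on the ball of radius \<open>\<eta>\<close> is of
  order \<open>\<eta>\<close>. For small \<open>\<eta>\<close> the Picard operator is therefore a contraction on the whole interval \<open>{a..b}\<close>
  at once, and no continuation argument is needed.
\<close>

lemma small_solution:
  fixes B C :: "real \<Rightarrow> real"
  assumes ab: "a \<le> b" and B: "continuous_on {a..b} B" and C: "continuous_on {a..b} C"
  obtains \<delta> where "\<delta> > 0"
    "\<And>r. \<bar>r\<bar> < \<delta> \<Longrightarrow> \<exists>v. v a = r \<and> (\<forall>t\<in>{a..b}. \<bar>v t\<bar> \<le> 1 \<and>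
       (v has_real_derivative B t * v t ^ 2 + C t * v t ^ 3) (at t within {a..b}))"
proof -
  have "bounded (B ` {a..b})" "bounded (C ` {a..b})"
    using B C by (auto intro: compact_imp_bounded compact_continuous_image)
  then obtain MB MC where "\<And>t. t \<in> {a..b} \<Longrightarrow> \<bar>B t\<bar> \<le> MB" "\<And>t. t \<in> {a..b} \<Longrightarrow> \<bar>C t\<bar> \<le> MC"
    unfolding bounded_iff by (metis image_eqI real_norm_def)
  define M where "M = max 1 (max MB MC)"
  have M: "M \<ge> 1" "\<And>t. t \<in> {a..b} \<Longrightarrow> \<bar>B t\<bar> \<le> M" "\<And>t. t \<in> {a..b} \<Longrightarrow> \<bar>C t\<bar> \<le> M"
    using \<open>\<And>t. t \<in> {a..b} \<Longrightarrow> \<bar>B t\<bar> \<le> MB\<close> \<open>\<And>t. t \<in> {a..b} \<Longrightarrow> \<bar>C t\<bar> \<le> MC\<close>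
    by (force simp: M_def)+
  \<comment> \<open>Chosen so that the contraction constant \<open>5 * M * \<eta> * (b - a)\<close> is at most \<open>1 / 2\<close>.\<close>
  define \<eta> where "\<eta> = 1 / (10 * M * (b - a + 1))"
  have \<eta>: "0 < \<eta>" "\<eta> \<le> 1" "5 * M * \<eta> * (b - a) \<le> 1 / 2"
  proof -
    have *: "M * (b - a + 1) \<ge> 1" using M(1) ab by (intro mult_ge1_I) auto
    then show "0 < \<eta>" "\<eta> \<le> 1" by (auto simp: \<eta>_def mult.assoc)
    have "5 * M * \<eta> * (b - a) \<le> 5 * M * \<eta> * (b - a + 1)" using M(1) \<open>0 < \<eta>\<close> by (intro mult_left_mono) auto
    also have "\<dots> = 1 / 2" using M(1) ab by (simp add: \<eta>_def)
    finally show "5 * M * \<eta> * (b - a) \<le> 1 / 2" .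
  qed
  define N where "N v t = B t * v t ^ 2 + C t * v t ^ 3" for v :: "real \<Rightarrow> real" and t
  have cN: "continuous_on {a..b} (N v)" if "continuous_on {a..b} v" for v
    unfolding N_def using B C that by (intro continuous_intros)
  have lipN: "\<bar>N v t - N w t\<bar> \<le> 5 * M * \<eta> * \<bar>v t - w t\<bar>"
    if "t \<in> {a..b}" "\<bar>v t\<bar> \<le> \<eta>" "\<bar>w t\<bar> \<le> \<eta>" for v w t
    unfolding N_def using that M \<eta> by (intro quadratic_cubic_lipschitz) auto
  have sol: "\<exists>v. v a = r \<and> (\<forall>t\<in>{a..b}. \<bar>v t\<bar> \<le> 1 \<and>
       (v has_real_derivative B t * v t ^ 2 + C t * v t ^ 3) (at t within {a..b}))"
    if r: "\<bar>r\<bar> < \<eta> / 2" for r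
  proof -
    \<comment> \<open>Bounded continuous functions live on the whole line; clamping the upper limit extends the
      Picard operator constantly beyond \<open>{a..b}\<close>.\<close>
    have "\<exists>w :: real \<Rightarrow>\<^sub>C real. \<forall>t. w t = r + integral {a..clamp a b t} (N (apply_bcontfun v))" for v :: "real \<Rightarrow>\<^sub>C real"
    proof -
      have "continuous_on (cbox a b) (\<lambda>t. r + integral {a..t} (N (apply_bcontfun v)))"
        unfolding cbox_interval
        by (intro continuous_intros indefinite_integral_continuous_1 integrable_continuous_real cN) auto
      from continuous_on_cbox_bcontfunE[OF this] show ?thesis by metis
    qed
    then obtain \<Phi> :: "(real \<Rightarrow>\<^sub>C real) \<Rightarrow> (real \<Rightarrow>\<^sub>C real)"
      where \<Phi>: "\<And>v t. \<Phi> v t = r + integral {a..clamp a b t} (N (apply_bcontfun v))"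
      by metis
    have cl: "clamp a b t \<in> {a..b}" for t using clamp_in_interval[of a b t] ab by auto
    have small: "\<bar>v t\<bar> \<le> \<eta>" if "v \<in> cball 0 \<eta>" for v :: "real \<Rightarrow>\<^sub>C real" and t
      using that norm_bounded[of v t] by auto
    have contr: "dist (\<Phi> v) (\<Phi> w) \<le> 1 / 2 * dist v w"
      if vw: "v \<in> cball 0 \<eta>" "w \<in> cball 0 \<eta>" for v w
    proof (rule dist_bound)
      fix t
      define c where "c = clamp a b t"
      have c: "c \<in> {a..b}" using cl c_def by auto
      have sub: "continuous_on {a..c} h" if "continuous_on {a..b} h" for h :: "real \<Rightarrow> real"
        using c by (auto intro: continuous_on_subset[OF that])
      have "\<Phi> v t - \<Phi> w t = integral {a..c} (\<lambda>s. N (apply_bcontfun v) s - N (apply_bcontfun w) s)"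
        unfolding \<Phi> c_def[symmetric]
        by (subst integral_diff) (auto intro!: integrable_continuous_real sub cN)
      moreover have "norm \<dots> \<le> 5 * M * \<eta> * dist v w * (c - a)"
      proof (rule integral_bound)
        show "continuous_on {a..c} (\<lambda>s. N (apply_bcontfun v) s - N (apply_bcontfun w) s)"
          by (intro continuous_intros sub cN) auto
        fix s assume s: "s \<in> {a..c}"
        have "\<bar>N (apply_bcontfun v) s - N (apply_bcontfun w) s\<bar> \<le> 5 * M * \<eta> * \<bar>v s - w s\<bar>"
          using s c vw by (intro lipN small) auto
        also have "\<dots> \<le> 5 * M * \<eta> * dist v w"
          using M \<eta> dist_bounded[of v s w] by (intro mult_left_mono) (auto simp: dist_real_def)
        finally show "norm (N (apply_bcontfun v) s - N (apply_bcontfun w) s) \<le> 5 * M * \<eta> * dist v w"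
          by simp
      qed (use c in auto)
      moreover have "5 * M * \<eta> * dist v w * (c - a) \<le> 5 * M * \<eta> * dist v w * (b - a)"
        using c M \<eta> by (intro mult_left_mono) auto
      moreover have "5 * M * \<eta> * dist v w * (b - a) \<le> 1 / 2 * dist v w"
      proof -
        have "5 * M * \<eta> * dist v w * (b - a) = 5 * M * \<eta> * (b - a) * dist v w"
          by (simp only: mult_ac)
        also have "\<dots> \<le> 1 / 2 * dist v w" using \<eta>(3) by (intro mult_right_mono) auto
        finally show ?thesis .
      qed
      ultimately show "dist (\<Phi> v t) (\<Phi> w t) \<le> 1 / 2 * dist v w"
        by (simp add: dist_real_def)
    qed
    have \<Phi>0: "norm (\<Phi> 0) \<le> \<eta> / 2"
    proof (rule norm_bound)
      fix t
      have "N (apply_bcontfun 0) = (\<lambda>_. 0)" by (auto simp: N_def zero_bcontfun.rep_eq)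
      then show "norm (\<Phi> 0 t) \<le> \<eta> / 2" using r by (simp add: \<Phi>)
    qed
    have "\<exists>!v\<in>cball 0 \<eta>. \<Phi> v = v"
    proof (rule Banach_fix[where c = "1 / 2"])
      show "complete (cball (0 :: real \<Rightarrow>\<^sub>C real) \<eta>)" by (simp add: complete_eq_closed)
      show "\<Phi> ` cball 0 \<eta> \<subseteq> cball 0 \<eta>"
      proof safe
        fix v :: "real \<Rightarrow>\<^sub>C real" assume v: "v \<in> cball 0 \<eta>"
        have "norm (\<Phi> v) \<le> dist (\<Phi> v) (\<Phi> 0) + norm (\<Phi> 0)"
          by (metis dist_0_norm dist_triangle dist_commute)
        also have "\<dots> \<le> 1 / 2 * dist v 0 + \<eta> / 2"
          using contr[OF v, of 0] \<Phi>0 \<eta> by (intro add_mono) auto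
        also have "\<dots> \<le> \<eta>" using v by simp
        finally show "\<Phi> v \<in> cball 0 \<eta>" by simp
      qed
    qed (use \<eta> contr in auto)
    then obtain v where v: "v \<in> cball 0 \<eta>" "\<Phi> v = v" by blast
    have veq: "v t = r + integral {a..t} (N (apply_bcontfun v))" if "t \<in> {a..b}" for t
      using \<Phi>[of v t] v(2) that by simp
    have "(v has_real_derivative N (apply_bcontfun v) t) (at t within {a..b})" if t: "t \<in> {a..b}" for t
    proof -
      have "((\<lambda>t. r + integral {a..t} (N (apply_bcontfun v))) has_real_derivative N (apply_bcontfun v) t)
          (at t within {a..b})"
        using integral_has_real_derivative[OF cN t, of "apply_bcontfun v"] by (auto intro!: derivative_eq_intros)
      then show ?thesis
        by (rule has_field_derivative_transform_within[OF _ zero_less_one]) (use t veq in auto)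
    qed
    moreover have "v a = r" using veq[of a] ab by simp
    moreover have "\<bar>v t\<bar> \<le> 1" for t by (rule order_trans[OF small[OF v(1)] \<eta>(2)])
    ultimately show ?thesis
      unfolding N_def by (intro exI[of _ "apply_bcontfun v"] conjI ballI) auto
  qed
  show ?thesis by (rule that[of "\<eta> / 2"]) (use \<eta>(1) sol in auto)
qed

section \<open>The Abel equation and its Poincare map\<close>

locale abel_equation =
  fixes f g :: "real \<Rightarrow> real" and t0 :: real
  assumes cont_f: "continuous_on {t0..t0 + 2 * pi} f"
    and cont_g: "continuous_on {t0..t0 + 2 * pi} g"
begin

abbreviation T :: real where "T \<equiv> t0 + 2 * pi"

abbreviation rhs :: "real \<Rightarrow> real \<Rightarrow> real" where
  "rhs \<equiv> \<lambda>t y. g t * y ^ 3 + f t * y ^ 2"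

text \<open>
  The slope in \<open>y\<close> of the right-hand side between \<open>y\<close> and \<open>z\<close>, written as a polynomial so that it is
  continuous also where \<open>y = z\<close>; there it is the partial derivative.
\<close>

definition secant_slope :: "real \<Rightarrow> real \<Rightarrow> real \<Rightarrow> real" where
  "secant_slope t y z = g t * (y^2 + y * z + z^2) + f t * (y + z)"

lemma rhs_diff: "rhs t z - rhs t y = secant_slope t y z * (z - y)"
  by (simp add: secant_slope_def algebra_simps power2_eq_square power3_eq_cube)

lemma solution_continuous: "solution F t0 y \<Longrightarrow> continuous_on {t0..T} y"
  unfolding solution_def by (rule DERIV_continuous_on) blast

lemma continuous_on_secant_slope:
  assumes "continuous_on {t0..T} y" "continuous_on {t0..T} z"
  shows "continuous_on {t0..T} (\<lambda>t. secant_slope t (y t) (z t))"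
  unfolding secant_slope_def using assms cont_f cont_g by (intro continuous_intros)

text \<open>
  By \<open>rhs_diff\<close> the difference solves a homogeneous linear equation whose coefficient is the secant
  slope. Uniqueness, Lipschitz dependence and differentiability in the initial value all come from
  this formula.
\<close>

lemma solution_difference:
  assumes y: "solution rhs t0 y" and z: "solution rhs t0 z" and t: "t \<in> {t0..T}"
  shows "z t - y t = (z t0 - y t0) * exp (integral {t0..t} (\<lambda>s. secant_slope s (y s) (z s)))"
proof -
  define q where "q s = secant_slope s (y s) (z s)" for s
  have cq: "continuous_on {t0..T} q"
    unfolding q_def by (intro continuous_on_secant_slope solution_continuous[OF y] solution_continuous[OF z])
  define w where "w s = (z s - y s) / exp (integral {t0..s} q)" for s
  have "\<exists>c. \<forall>s\<in>{t0..T}. w s = c"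
  proof (rule has_field_derivative_zero_constant)
    fix s assume s: "s \<in> {t0..T}"
    have dy: "(y has_real_derivative rhs s (y s)) (at s within {t0..T})"
      and dz: "(z has_real_derivative rhs s (z s)) (at s within {t0..T})"
      using y z s by (auto simp: solution_def)
    have "rhs s (z s) - rhs s (y s) = q s * (z s - y s)" unfolding q_def by (rule rhs_diff)
    then show "(w has_real_derivative 0) (at s within {t0..T})"
      unfolding w_def
      by (intro DERIV_cong[OF DERIV_divide[OF DERIV_diff[OF dz dy]
            has_real_derivative_exp_integral[OF cq s]]]) simp_all
  qed simp
  then have "w t = w t0" using t by auto
  then show ?thesis by (simp add: w_def q_def[symmetric] field_simps)
qed

lemma solution_unique:
  assumes "solution rhs t0 y" "solution rhs t0 z" "y t0 = z t0" "t \<in> {t0..T}"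
  shows "y t = z t"
  using solution_difference[OF assms(1,2,4)] assms(3) by simp

lemma poincare_solution:
  assumes "solution rhs t0 y"
  shows "poincare rhs t0 (y t0) = y T"
  unfolding poincare_def
proof (rule the_equality)
  fix v assume "\<exists>z. solution rhs t0 z \<and> z t0 = y t0 \<and> z T = v"
  then show "v = y T" using solution_unique[OF assms, of _ T] by fastforce
qed (use assms in auto)

text \<open>
  Write a nearby solution as \<open>x + E v\<close>, where \<open>E\<close> solves the equation linearised along \<open>x\<close>. This removes
  the linear part and leaves \<open>v' = (3 g x + f) E v\<^sup>2 + g E\<^sup>2 v\<^sup>3\<close>, for which \<open>small_solution\<close> applies.
\<close>

lemma nearby_solutions:
  assumes x: "solution rhs t0 x"
  obtains \<delta> K where "\<delta> > 0"
    "\<And>r. \<bar>r - x t0\<bar> < \<delta> \<Longrightarrow> \<exists>y. solution rhs t0 y \<and> y t0 = r \<and> (\<forall>t\<in>{t0..T}. \<bar>y t\<bar> \<le> K)"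
proof -
  have cx: "continuous_on {t0..T} x" by (rule solution_continuous[OF x])
  define A where "A t = 3 * g t * x t ^ 2 + 2 * f t * x t" for t
  have cA: "continuous_on {t0..T} A"
    unfolding A_def using cont_f cont_g cx by (intro continuous_intros)
  define E where "E t = exp (integral {t0..t} A)" for t
  have dE: "(E has_real_derivative E t * A t) (at t within {t0..T})" if "t \<in> {t0..T}" for t
    unfolding E_def by (rule has_real_derivative_exp_integral[OF cA that])
  have cE: "continuous_on {t0..T} E" by (rule DERIV_continuous_on) (use dE in blast)
  define B where "B t = (3 * g t * x t + f t) * E t" for t
  define C where "C t = g t * E t ^ 2" for t
  have "continuous_on {t0..T} B" "continuous_on {t0..T} C"
    unfolding B_def C_def using cont_f cont_g cx cE by (auto intro!: continuous_intros)
  then obtain \<delta> where \<delta>: "\<delta> > 0" "\<And>r. \<bar>r\<bar> < \<delta> \<Longrightarrow> \<exists>v. v t0 = r \<and> (\<forall>t\<in>{t0..T}. \<bar>v t\<bar> \<le> 1 \<and>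
       (v has_real_derivative B t * v t ^ 2 + C t * v t ^ 3) (at t within {t0..T}))"
    using small_solution[of t0 T B C] pi_ge_zero by (smt (verit))
  have "bounded (x ` {t0..T})" "bounded (E ` {t0..T})"
    using cx cE by (auto intro: compact_imp_bounded compact_continuous_image)
  then obtain Kx KE where K: "\<And>t. t \<in> {t0..T} \<Longrightarrow> \<bar>x t\<bar> \<le> Kx" "\<And>t. t \<in> {t0..T} \<Longrightarrow> \<bar>E t\<bar> \<le> KE"
    unfolding bounded_iff by (metis image_eqI real_norm_def)
  show ?thesis
  proof (rule that[OF \<delta>(1)])
    fix r assume "\<bar>r - x t0\<bar> < \<delta>"
    then obtain v where v0: "v t0 = r - x t0" and v1: "\<And>t. t \<in> {t0..T} \<Longrightarrow> \<bar>v t\<bar> \<le> 1"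
      and dv: "\<And>t. t \<in> {t0..T} \<Longrightarrow>
        (v has_real_derivative B t * v t ^ 2 + C t * v t ^ 3) (at t within {t0..T})"
      using \<delta>(2) by blast
    define y where "y t = x t + E t * v t" for t
    have "solution rhs t0 y"
      unfolding solution_def
    proof
      fix t assume t: "t \<in> {t0..T}"
      have dx: "(x has_real_derivative rhs t (x t)) (at t within {t0..T})"
        using x t by (auto simp: solution_def)
      show "(y has_real_derivative rhs t (y t)) (at t within {t0..T})"
        unfolding y_def
        by (rule DERIV_cong[OF DERIV_add[OF dx DERIV_mult[OF dE[OF t] dv[OF t]]]])
          (simp add: A_def B_def C_def algebra_simps power2_eq_square power3_eq_cube)
    qed
    moreover have "y t0 = r" by (simp add: y_def E_def v0)
    moreover have "\<bar>y t\<bar> \<le> Kx + KE" if t: "t \<in> {t0..T}" for t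
    proof -
      have "\<bar>E t * v t\<bar> \<le> KE * 1" 
        unfolding abs_mult using K(2)[OF t] v1[OF t] by (intro mult_mono) auto
      then show ?thesis using K(1)[OF t] unfolding y_def by linarith
    qed
    ultimately show "\<exists>y. solution rhs t0 y \<and> y t0 = r \<and> (\<forall>t\<in>{t0..T}. \<bar>y t\<bar> \<le> Kx + KE)" by blast
  qed
qed

text \<open>
  In the difference formula the quotient \<open>(Y q t - Y r t) / (q - r)\<close> is an explicit exponential that
  is continuous in \<open>q\<close> up to \<open>q = r\<close>, which gives the first derivative \<open>V r t\<close>. The second derivative
  follows by differentiating \<open>V r T\<close> under the integral sign.
\<close>

lemma poincare_twice_differentiable:
  assumes x: "solution rhs t0 x"
  obtains \<delta> L1 L2 where "\<delta> > 0"
    "\<And>r. \<bar>r - x t0\<bar> < \<delta> \<Longrightarrow> (poincare rhs t0 has_real_derivative L1 r) (at r)"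
    "\<And>r. \<bar>r - x t0\<bar> < \<delta> \<Longrightarrow> (L1 has_real_derivative L2 r) (at r)"
    "L1 (x t0) = exp (integral {t0..T} (\<lambda>t. 3 * g t * x t ^ 2 + 2 * f t * x t))"
    "L2 (x t0) = L1 (x t0) * integral {t0..T} (\<lambda>t. (6 * g t * x t + 2 * f t) *
        exp (integral {t0..t} (\<lambda>s. 3 * g s * x s ^ 2 + 2 * f s * x s)))"
proof -
  obtain \<delta> K where \<delta>: "\<delta> > 0"
    "\<And>r. \<bar>r - x t0\<bar> < \<delta> \<Longrightarrow> \<exists>y. solution rhs t0 y \<and> y t0 = r \<and> (\<forall>t\<in>{t0..T}. \<bar>y t\<bar> \<le> K)"
    using nearby_solutions[OF x] by blast
  define U where "U = {r. \<bar>r - x t0\<bar> < \<delta>}"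
  have U: "open U" "convex U" "x t0 \<in> U"
  proof -
    have *: "U = ball (x t0) \<delta>" by (auto simp: U_def ball_def dist_real_def)
    show "open U" "convex U" "x t0 \<in> U" unfolding * using \<delta>(1) by auto
  qed
  have "\<forall>r\<in>U. \<exists>y. solution rhs t0 y \<and> y t0 = r \<and> (\<forall>t\<in>{t0..T}. \<bar>y t\<bar> \<le> K)"
    using \<delta>(2) by (simp add: U_def)
  from bchoice[OF this] obtain Y where "\<forall>r\<in>U. solution rhs t0 (Y r) \<and> Y r t0 = r \<and> (\<forall>t\<in>{t0..T}. \<bar>Y r t\<bar> \<le> K)"
    ..
  then have Y: "\<And>r. r \<in> U \<Longrightarrow> solution rhs t0 (Y r)"
    "\<And>r. r \<in> U \<Longrightarrow> Y r t0 = r" "\<And>r t. r \<in> U \<Longrightarrow> t \<in> {t0..T} \<Longrightarrow> \<bar>Y r t\<bar> \<le> K"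
    by auto
  have cY: "continuous_on {t0..T} (Y r)" if "r \<in> U" for r
    by (rule solution_continuous[OF Y(1)[OF that]])
  have "bounded (f ` {t0..T})" "bounded (g ` {t0..T})"
    using cont_f cont_g by (auto intro: compact_imp_bounded compact_continuous_image)
  then obtain Kf Kg where K: "\<And>t. t \<in> {t0..T} \<Longrightarrow> \<bar>f t\<bar> \<le> Kf" "\<And>t. t \<in> {t0..T} \<Longrightarrow> \<bar>g t\<bar> \<le> Kg"
    unfolding bounded_iff by (metis image_eqI real_norm_def)
  have nonneg: "0 \<le> Kf" "0 \<le> Kg" "0 \<le> K" "t0 \<le> T"
    using K[of t0] Y(3)[OF U(3), of t0] by auto
  define Q where "Q = Kg * (K * K + K * K + K * K) + Kf * (K + K)"
  have slope_bound: "\<bar>secant_slope t a b\<bar> \<le> Q" if t: "t \<in> {t0..T}" and ab: "\<bar>a\<bar> \<le> K" "\<bar>b\<bar> \<le> K" for t a b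
  proof -
    have "\<bar>a * a + a * b + b * b\<bar> \<le> K * K + K * K + K * K"
    proof -
      have "\<bar>c * d\<bar> \<le> K * K" if "\<bar>c\<bar> \<le> K" "\<bar>d\<bar> \<le> K" for c d
        unfolding abs_mult using that nonneg by (intro mult_mono) auto
      from this[of a a] this[of a b] this[of b b] ab show ?thesis by linarith
    qed
    moreover have "\<bar>a + b\<bar> \<le> K + K" using ab by linarith
    ultimately show ?thesis
      unfolding secant_slope_def Q_def power2_eq_square using K[OF t] nonneg
      by (intro order_trans[OF abs_triangle_ineq] add_mono) (auto simp: abs_mult intro!: mult_mono)
  qed
  have diff: "Y r t - Y q t = (r - q) * exp (integral {t0..t} (\<lambda>s. secant_slope s (Y q s) (Y r s)))"
    if "q \<in> U" "r \<in> U" "t \<in> {t0..T}" for q r t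
    using solution_difference[OF Y(1)[OF that(1)] Y(1)[OF that(2)] that(3)] Y(2) that by simp

  \<comment> \<open>The flow is Lipschitz in the initial value, hence jointly continuous.\<close>
  have lip: "\<bar>Y r t - Y q t\<bar> \<le> exp (Q * (T - t0)) * \<bar>r - q\<bar>"
    if q: "q \<in> U" and r: "r \<in> U" and t: "t \<in> {t0..T}" for q r t
  proof -
    have "norm (integral {t0..t} (\<lambda>s. secant_slope s (Y q s) (Y r s))) \<le> Q * (t - t0)"
      using t q r Y(3) slope_bound
      by (intro integral_bound continuous_on_subset[OF continuous_on_secant_slope[OF cY[OF q] cY[OF r]]]) auto
    moreover have "Q * (t - t0) \<le> Q * (T - t0)"
      using t nonneg by (intro mult_left_mono) (auto simp: Q_def)
    ultimately have "exp (integral {t0..t} (\<lambda>s. secant_slope s (Y q s) (Y r s))) \<le> exp (Q * (T - t0))" by simp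
    from mult_right_mono[OF this, of "\<bar>r - q\<bar>"] show ?thesis
      unfolding diff[OF q r t] abs_mult by (simp add: mult.commute)
  qed
  have jcY: "continuous_on (U \<times> {t0..T}) (\<lambda>(r, t). Y r t)"
    by (rule continuous_on_swap_args[OF continuous_on_Times_lipschitz]) (use cY lip in auto)
  have jc: "continuous_on (U \<times> {t0..T}) (\<lambda>p. Y (fst p) (snd p))"
    using jcY by (simp add: case_prod_unfold)
  have cfg: "continuous_on (U \<times> {t0..T}) (\<lambda>p. f (snd p))" "continuous_on (U \<times> {t0..T}) (\<lambda>p. g (snd p))"
    by (auto intro!: continuous_on_compose2[OF cont_f] continuous_on_compose2[OF cont_g] continuous_intros)

  define A where "A r t = 3 * g t * Y r t ^ 2 + 2 * f t * Y r t" for r t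
  define V where "V r t = exp (integral {t0..t} (A r))" for r t
  have A_slope: "A r = (\<lambda>t. secant_slope t (Y r t) (Y r t))" for r
    by (auto simp: A_def secant_slope_def power2_eq_square)
  have dY: "((\<lambda>r. Y r t) has_real_derivative V r t) (at r)" if r: "r \<in> U" and t: "t \<in> {t0..T}" for r t
  proof -
    \<comment> \<open>The slope function of the Caratheodory form of the derivative.\<close>
    define S where "S q = exp (integral {t0..t} (\<lambda>s. secant_slope s (Y r s) (Y q s)))" for q
    have cYr: "continuous_on (U \<times> {t0..T}) (\<lambda>p. Y r (snd p))"
      by (auto intro!: continuous_on_compose2[OF cY[OF r]] continuous_intros)
    have "continuous_on (U \<times> {t0..T}) (\<lambda>(q, s). secant_slope s (Y r s) (Y q s))"
      unfolding secant_slope_def case_prod_unfold by (intro continuous_intros cfg jc cYr)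
    then have "continuous_on (U \<times> cbox t0 t) (\<lambda>(q, s). secant_slope s (Y r s) (Y q s))"
      by (rule continuous_on_subset) (use t in auto)
    then have "continuous_on U (\<lambda>q. integral (cbox t0 t) (\<lambda>s. secant_slope s (Y r s) (Y q s)))"
      by (rule integral_continuous_on_param)
    then have "continuous_on U S"
      unfolding S_def cbox_interval by (rule continuous_on_exp)
    then have "isCont S r" using U(1) r by (simp add: continuous_on_eq_continuous_at)
    moreover have "S r = V r t" by (simp add: S_def V_def A_slope)
    moreover have "Y q t - Y r t = S q * (q - r)" if "q \<in> U" for q
      using diff[OF r that t] by (simp add: S_def)
    ultimately have "((\<lambda>q. if q \<in> U then Y q t else Y r t + S q * (q - r)) has_real_derivative V r t) (at r)"
      using r by (subst CARAT_DERIV) (auto intro!: exI[of _ S])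
    then show ?thesis
      by (rule has_field_derivative_transform_within_open[OF _ U(1) r]) auto
  qed
  have jcA: "continuous_on (U \<times> {t0..T}) (\<lambda>(r, t). A r t)"
    unfolding A_def case_prod_unfold by (intro continuous_intros cfg jc)
  have jcV: "continuous_on (U \<times> {t0..T}) (\<lambda>(r, t). V r t)"
  proof -
    have "continuous_on (U \<times> {t0..T}) (\<lambda>(r, t). integral {t0..t} (A r))"
      using slope_bound Y(3) by (intro continuous_on_integral_upto[OF jcA, of Q]) (auto simp: A_slope)
    then show ?thesis unfolding V_def case_prod_unfold by (intro continuous_intros)
  qed
  define L2 where "L2 r = V r T * integral {t0..T} (\<lambda>t. (6 * g t * Y r t + 2 * f t) * V r t)" for r
  have L1: "(poincare rhs t0 has_real_derivative V r T) (at r)" if r: "r \<in> U" for r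
  proof -
    have "poincare rhs t0 q = Y q T" if "q \<in> U" for q
      using poincare_solution[OF Y(1)[OF that]] Y(2)[OF that] by simp
    then show ?thesis
      using nonneg by (intro has_field_derivative_transform_within_open[OF dY[OF r, of T] U(1) r]) auto
  qed
  have L2: "((\<lambda>r. V r T) has_real_derivative L2 r) (at r)" if r: "r \<in> U" for r
  proof -
    have "((\<lambda>r. integral (cbox t0 T) (A r)) has_real_derivative
        integral (cbox t0 T) (\<lambda>t. (6 * g t * Y r t + 2 * f t) * V r t)) (at r within U)"
    proof (rule leibniz_rule_field_derivative)
      fix q t assume "q \<in> U" "t \<in> cbox t0 T"
      then show "((\<lambda>r. A r t) has_real_derivative (6 * g t * Y q t + 2 * f t) * V q t) (at q within U)"
        unfolding A_def
        by (auto intro!: derivative_eq_intros has_field_derivative_at_within[OF dY] simp: algebra_simps)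
    next
      fix q assume "q \<in> U"
      then show "A q integrable_on cbox t0 T"
        unfolding A_slope by (auto intro!: integrable_continuous_real continuous_on_secant_slope cY)
    next
      have "continuous_on (U \<times> {t0..T}) (\<lambda>p. V (fst p) (snd p))"
        using jcV by (simp add: case_prod_unfold)
      then have "continuous_on (U \<times> {t0..T}) (\<lambda>(r, t). (6 * g t * Y r t + 2 * f t) * V r t)"
        unfolding case_prod_unfold by (intro continuous_intros cfg jc)
      then show "continuous_on (U \<times> cbox t0 T) (\<lambda>(r, t). (6 * g t * Y r t + 2 * f t) * V r t)" by simp
    qed (use U r in auto)
    then have "((\<lambda>r. integral {t0..T} (A r)) has_real_derivative
        integral {t0..T} (\<lambda>t. (6 * g t * Y r t + 2 * f t) * V r t)) (at r)"
      unfolding cbox_interval at_within_open[OF r U(1)] .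
    from DERIV_fun_exp[OF this] show ?thesis by (simp only: L2_def V_def)
  qed
  have Yx: "Y (x t0) t = x t" if "t \<in> {t0..T}" for t
    by (rule solution_unique[OF Y(1)[OF U(3)] x Y(2)[OF U(3)] that])
  have Vx: "V (x t0) t = exp (integral {t0..t} (\<lambda>s. 3 * g s * x s ^ 2 + 2 * f s * x s))"
    if "t \<in> {t0..T}" for t
    unfolding V_def A_def using that Yx by (intro arg_cong[of _ _ exp] integral_cong) auto
  show ?thesis
  proof (rule that[OF \<delta>(1), of "\<lambda>r. V r T" L2])
    show "V (x t0) T = exp (integral {t0..T} (\<lambda>t. 3 * g t * x t ^ 2 + 2 * f t * x t))"
      using nonneg by (intro Vx) auto
    show "L2 (x t0) = V (x t0) T * integral {t0..T} (\<lambda>t. (6 * g t * x t + 2 * f t) *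
        exp (integral {t0..t} (\<lambda>s. 3 * g s * x s ^ 2 + 2 * f s * x s)))"
      unfolding L2_def by (intro arg_cong[of _ _ "(*) _"] integral_cong) (simp add: Vx Yx)
  qed (use L1 L2 in \<open>auto simp: U_def\<close>)
qed

end

section \<open>Signs between consecutive zeros\<close>

text \<open>
  A multiplier \<open>\<epsilon>\<close> instead of a case distinction lets both signs of \<open>g\<close> be treated at once.
\<close>

lemma constant_sign_on_interval:
  fixes g :: "real \<Rightarrow> real"
  assumes "continuous_on {p<..<q} g" "\<And>t. t \<in> {p<..<q} \<Longrightarrow> g t \<noteq> 0"
  obtains \<epsilon> :: real where "\<And>t. t \<in> {p<..<q} \<Longrightarrow> \<epsilon> * g t > 0"
proof -
  have conn: "connected (g ` {p<..<q})"
    by (rule connected_continuous_image[OF assms(1)]) simp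
  have same: "g s * g t > 0" if st: "s \<in> {p<..<q}" "t \<in> {p<..<q}" for s t
  proof (rule ccontr)
    assume "\<not> g s * g t > 0"
    then have "g s \<le> 0 \<and> 0 \<le> g t \<or> g t \<le> 0 \<and> 0 \<le> g s"
      by (auto simp: zero_less_mult_iff not_less) 
    then have "0 \<in> g ` {p<..<q}"
      using conn st by (meson connected_contains_Icc atLeastAtMost_iff imageI subsetD)
    then show False using assms(2) by auto
  qed
  show ?thesis by (rule that[of "g ((p + q) / 2)"]) (auto intro!: same)
qed

text \<open>
  The derivative is positive before and negative after the point where \<open>w\<close> crosses \<open>\<gamma>\<close>, so \<open>\<phi>\<close> rises
  from zero and then falls back to zero. At a given \<open>t\<close>, one compares with the end point on the same
  side of that crossing.
\<close>

lemma bump_between_zeros: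
  fixes \<phi> k w :: "real \<Rightarrow> real"
  assumes cont: "continuous_on {p..q} \<phi>" and zeros: "\<phi> p = 0" "\<phi> q = 0"
    and deriv: "\<And>t. t \<in> {p<..<q} \<Longrightarrow> (\<phi> has_real_derivative k t * (\<gamma> - w t)) (at t)"
    and k: "\<And>t. t \<in> {p<..<q} \<Longrightarrow> k t > 0"
    and mono: "strict_mono_on {p<..<q} w" and t: "t \<in> {p<..<q}"
  shows "\<phi> t > 0"
proof (cases "w t \<le> \<gamma>")
  case True
  have "\<phi> p < \<phi> t"
  proof (rule DERIV_pos_imp_increasing_open[where f = \<phi> and a = p and b = t])
    fix s assume s: "p < s" "s < t"
    then have "w s < w t" using t by (intro strict_mono_onD[OF mono]) auto
    then show "\<exists>y. (\<phi> has_real_derivative y) (at s) \<and> y > 0"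
      using s t True by (intro exI[of _ "k s * (\<gamma> - w s)"] conjI deriv mult_pos_pos k) auto
  qed (use t in \<open>auto intro: continuous_on_subset[OF cont]\<close>)
  then show ?thesis using zeros by simp
next
  case False
  have "\<phi> t > \<phi> q"
  proof (rule DERIV_neg_imp_decreasing_open[where f = \<phi> and a = t and b = q])
    fix s assume s: "t < s" "s < q"
    then have "w t < w s" using t by (intro strict_mono_onD[OF mono]) auto
    then show "\<exists>y. (\<phi> has_real_derivative y) (at s) \<and> y < 0"
      using s t False by (intro exI[of _ "k s * (\<gamma> - w s)"] conjI deriv mult_pos_neg k) auto
  qed (use t in \<open>auto intro: continuous_on_subset[OF cont]\<close>)
  then show ?thesis using zeros by simp
qed

text \<open>
  Since \<open>f + \<beta> g = g (\<beta> - u)\<close> with \<open>u = - f / g\<close>, this is \<open>bump_between_zeros\<close> for \<open>\<sigma> \<epsilon> \<phi>\<close>, where \<open>\<epsilon> g > 0\<close>. The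
  multiplier \<open>\<sigma>\<close> is \<open>1\<close> for increasing and \<open>-1\<close> for decreasing \<open>u\<close>. The numerator \<open>f + \<beta> g\<close> is kept because
  it makes sense at the zeros of \<open>g\<close> as well.
\<close>

lemma sign_between_zeros:
  fixes \<phi> \<kappa> f g :: "real \<Rightarrow> real"
  assumes cont: "continuous_on {p..q} \<phi>" and zeros: "\<phi> p = 0" "\<phi> q = 0"
    and deriv: "\<And>t. t \<in> {p<..<q} \<Longrightarrow> (\<phi> has_real_derivative \<kappa> t * (f t + \<beta> * g t)) (at t)"
    and \<kappa>: "\<And>t. t \<in> {p<..<q} \<Longrightarrow> \<kappa> t > 0"
    and g: "continuous_on {p<..<q} g" "\<And>t. t \<in> {p<..<q} \<Longrightarrow> g t \<noteq> 0"
    and mono: "strict_mono_on {p<..<q} (\<lambda>t. \<sigma> * - (f t / g t))" and t: "t \<in> {p<..<q}"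
  shows "\<sigma> * (g t * \<phi> t) > 0"
proof -
  obtain \<epsilon> where \<epsilon>: "\<And>t. t \<in> {p<..<q} \<Longrightarrow> \<epsilon> * g t > 0"
    using constant_sign_on_interval[OF g] by blast
  have "\<sigma> * \<epsilon> * \<phi> t > 0"
  proof (rule bump_between_zeros[OF _ _ _ _ _ mono t])
    fix s assume s: "s \<in> {p<..<q}"
    show "((\<lambda>t. \<sigma> * \<epsilon> * \<phi> t) has_real_derivative
        \<kappa> s * (\<epsilon> * g s) * (\<sigma> * \<beta> - \<sigma> * - (f s / g s))) (at s)"
      using g(2)[OF s] by (intro DERIV_cong[OF DERIV_cmult[OF deriv[OF s]]]) (simp add: field_simps)
    show "\<kappa> s * (\<epsilon> * g s) > 0" using \<kappa>[OF s] \<epsilon>[OF s] by simp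
  qed (use cont zeros in \<open>auto intro!: continuous_intros\<close>)
  then have "0 < (\<sigma> * \<epsilon> * \<phi> t) * (\<epsilon> * g t)" using \<epsilon>[OF t] by simp
  also have "\<dots> = \<epsilon>^2 * (\<sigma> * (g t * \<phi> t))" by (simp add: power2_eq_square)
  finally show ?thesis by (simp add: zero_less_mult_iff)
qed

text \<open>
  One of the two arcs between the zeros of \<open>g\<close> runs over the end of the period. This lemma continues
  a function given on one period differentiably beyond that point.
\<close>

lemma periodic_concatenation_derivative:
  fixes \<phi> w :: "real \<Rightarrow> real"
  assumes deriv: "\<And>t. t \<in> {a..a + P} \<Longrightarrow> (\<phi> has_real_derivative w t) (at t within {a..a + P})"
    and period: "\<phi> (a + P) = \<phi> a" "w (a + P) = w a" and t: "t \<in> {a<..<a + 2 * P}"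
  shows "((\<lambda>t. if t \<le> a + P then \<phi> t else \<phi> (t - P)) has_real_derivative
    (if t \<le> a + P then w t else w (t - P))) (at t)"
proof -
  define \<psi> where "\<psi> t = (if t \<le> a + P then \<phi> t else \<phi> (t - P))" for t
  define w' where "w' t = (if t \<le> a + P then w t else w (t - P))" for t
  have P: "P > 0" using t by auto
  have left: "(\<psi> has_real_derivative w' s) (at s within {a..a + P})" if s: "s \<in> {a..a + P}" for s
  proof -
    have "(\<psi> has_real_derivative w s) (at s within {a..a + P})"
      by (rule has_field_derivative_transform_within[OF deriv[OF s] zero_less_one s]) (auto simp: \<psi>_def)
    then show ?thesis using s by (simp add: w'_def)
  qed
  have right: "(\<psi> has_real_derivative w' s) (at s within {a + P..a + 2 * P})"
    if s: "s \<in> {a + P..a + 2 * P}" for s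
  proof -
    have "((\<lambda>s. s - P) has_real_derivative 1) (at s within {a + P..a + 2 * P})"
      by (auto intro!: derivative_eq_intros)
    moreover have "(\<phi> has_real_derivative w (s - P)) (at (s - P) within (\<lambda>s. s - P) ` {a + P..a + 2 * P})"
      by (rule DERIV_subset[OF deriv]) (use s in auto)
    ultimately have "((\<lambda>s. \<phi> (s - P)) has_real_derivative w (s - P)) (at s within {a + P..a + 2 * P})"
      using DERIV_image_chain[of \<phi> "w (s - P)" "\<lambda>s. s - P" s "{a + P..a + 2 * P}" 1]
      unfolding o_def mult_1_right by blast
    then have "(\<psi> has_real_derivative w (s - P)) (at s within {a + P..a + 2 * P})"
      by (rule has_field_derivative_transform_within[OF _ zero_less_one s])
        (use period in \<open>auto simp: \<psi>_def\<close>)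
    then show ?thesis using s period by (auto simp: w'_def)
  qed
  have inside: "(\<psi> has_real_derivative w' t) (at t)"
    if "(\<psi> has_real_derivative w' t) (at t within S)" "t \<in> interior S" for S
    using that by (metis at_within_interior)
  consider "t < a + P" | "t > a + P" | "t = a + P" by linarith
  then have "(\<psi> has_real_derivative w' t) (at t)"
  proof cases
    case 1
    then show ?thesis using t by (intro inside[OF left]) auto
  next
    case 2
    then show ?thesis using t by (intro inside[OF right]) auto
  next
    case 3
    have "(\<psi> has_real_derivative w' t) (at t within {a..a + P} \<union> {a + P..a + 2 * P})"
      using left[of t] right[of t] 3 P unfolding has_field_derivative_iff by (intro Lim_Un) auto
    moreover have "{a..a + P} \<union> {a + P..a + 2 * P} = {a..a + 2 * P}" using P by auto
    ultimately show ?thesis using t by (intro inside[of "{a..a + 2 * P}"]) auto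
  qed
  then show ?thesis unfolding \<psi>_def w'_def .
qed

section \<open>The second variation along a closed orbit\<close>

lemma integral_derivative_closed:
  fixes F k :: "real \<Rightarrow> real"
  assumes "a \<le> b" "\<And>t. t \<in> {a..b} \<Longrightarrow> (F has_real_derivative k t) (at t within {a..b})" "F b = F a"
  shows "(k has_integral 0) {a..b}"
  using fundamental_theorem_of_calculus[of a b F k] assms
  by (simp add: has_real_derivative_iff_has_vector_derivative)

context abel_equation
begin

text \<open>
  The factor by which the first variation along \<open>x\<close> differs from \<open>(x t / x t0)\<^sup>2\<close>; at the end of the
  period of a closed orbit with \<open>x t0 \<noteq> 0\<close> it is the derivative of the Poincare map.
\<close>

definition weight :: "(real \<Rightarrow> real) \<Rightarrow> real \<Rightarrow> real" where
  "weight x t = exp (integral {t0..t} (\<lambda>s. g s * x s ^ 2))"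

lemma weight_pos: "weight x t > 0"
  by (simp add: weight_def)

lemma weight_start: "weight x t0 = 1"
  by (simp add: weight_def)

lemma weight_deriv:
  assumes "solution rhs t0 x" "t \<in> {t0..T}"
  shows "(weight x has_real_derivative weight x t * (g t * x t ^ 2)) (at t within {t0..T})"
  unfolding weight_def
  by (intro has_real_derivative_exp_integral continuous_intros cont_g solution_continuous[OF assms(1)] assms(2))

lemma continuous_on_weight:
  assumes "solution rhs t0 x"
  shows "continuous_on {t0..T} (weight x)"
  by (rule DERIV_continuous_on) (rule weight_deriv[OF assms])

lemma solution_deriv:
  assumes "solution rhs t0 x" "t \<in> {t0..T}"
  shows "(x has_real_derivative rhs t (x t)) (at t within {t0..T})"
  using assms by (simp add: solution_def)

text \<open>
  Both sides solve the variational equation \<open>w' = (3 g x\<^sup>2 + 2 f x) w\<close> and agree at \<open>t0\<close>; note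
  \<open>(x\<^sup>2)' = 2 (g x\<^sup>2 + f x) x\<^sup>2\<close>.
\<close>

lemma first_variation_weight:
  assumes x: "solution rhs t0 x" and t: "t \<in> {t0..T}"
  shows "x t0 ^ 2 * exp (integral {t0..t} (\<lambda>s. 3 * g s * x s ^ 2 + 2 * f s * x s)) = x t ^ 2 * weight x t"
proof -
  define A where "A s = 3 * g s * x s ^ 2 + 2 * f s * x s" for s
  have cA: "continuous_on {t0..T} A"
    unfolding A_def using cont_f cont_g solution_continuous[OF x] by (intro continuous_intros)
  define w where "w s = x s * x s * weight x s / exp (integral {t0..s} A)" for s
  have "\<exists>c. \<forall>s\<in>{t0..T}. w s = c"
  proof (rule has_field_derivative_zero_constant)
    fix s assume s: "s \<in> {t0..T}"
    show "(w has_real_derivative 0) (at s within {t0..T})"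
      unfolding w_def
      by (rule DERIV_cong[OF DERIV_divide[OF DERIV_mult[OF DERIV_mult[OF solution_deriv[OF x s]
            solution_deriv[OF x s]] weight_deriv[OF x s]] has_real_derivative_exp_integral[OF cA s]]])
        (simp_all add: A_def algebra_simps power2_eq_square power3_eq_cube)
  qed simp
  then have "w t = w t0" using t by auto
  then show ?thesis
    unfolding A_def[symmetric] by (simp add: w_def weight_start power2_eq_square field_simps)
qed

text \<open>
  After replacing the first variation by \<open>x\<^sup>2 e\<close>, the integrand is \<open>(6 g x\<^sup>3 + 2 f x\<^sup>2) e\<close>, which equals
  \<open>2 (x e)' + 2 g x\<^sup>3 e\<close>, and \<open>x e\<close> returns to its initial value.
\<close>

lemma second_variation_weight:
  assumes x: "solution rhs t0 x" and closed: "x T = x t0" "weight x T = 1"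
  shows "x t0 ^ 2 * integral {t0..T} (\<lambda>t. (6 * g t * x t + 2 * f t) *
      exp (integral {t0..t} (\<lambda>s. 3 * g s * x s ^ 2 + 2 * f s * x s)))
    = 2 * integral {t0..T} (\<lambda>t. g t * x t ^ 3 * weight x t)"
proof -
  let ?V = "\<lambda>t. exp (integral {t0..t} (\<lambda>s. 3 * g s * x s ^ 2 + 2 * f s * x s))"
  define k where "k t = rhs t (x t) * weight x t + weight x t * (g t * x t ^ 2) * x t" for t
  have "(k has_integral 0) {t0..T}"
  proof (rule integral_derivative_closed)
    fix t assume t: "t \<in> {t0..T}"
    show "((\<lambda>t. x t * weight x t) has_real_derivative k t) (at t within {t0..T})"
      unfolding k_def by (rule DERIV_mult[OF solution_deriv[OF x t] weight_deriv[OF x t]])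
  qed (use closed weight_start in auto)
  from has_integral_mult_right[OF this, of 2]
  have k: "((\<lambda>t. 2 * k t) has_integral 0) {t0..T}" by simp
  have "(\<lambda>t. g t * x t ^ 3 * weight x t) integrable_on {t0..T}"
    by (intro integrable_continuous_real continuous_intros cont_g solution_continuous[OF x]
        continuous_on_weight[OF x])
  from has_integral_mult_right[OF integrable_integral[OF this], of 2]
  have "((\<lambda>t. 2 * k t + 2 * (g t * x t ^ 3 * weight x t)) has_integral
      2 * integral {t0..T} (\<lambda>t. g t * x t ^ 3 * weight x t)) {t0..T}"
    using has_integral_add[OF k] by fastforce
  moreover have "x t0 ^ 2 * ((6 * g t * x t + 2 * f t) * ?V t)
      = 2 * k t + 2 * (g t * x t ^ 3 * weight x t)" if t: "t \<in> {t0..T}" for t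
  proof -
    have "x t0 ^ 2 * ((6 * g t * x t + 2 * f t) * ?V t)
        = (6 * g t * x t + 2 * f t) * (x t0 ^ 2 * ?V t)" by (simp only: mult_ac)
    also have "\<dots> = (6 * g t * x t + 2 * f t) * (x t ^ 2 * weight x t)"
      by (simp only: first_variation_weight[OF x t])
    also have "\<dots> = 2 * k t + 2 * (g t * x t ^ 3 * weight x t)"
      by (simp add: k_def algebra_simps power2_eq_square power3_eq_cube)
    finally show ?thesis .
  qed
  ultimately have "((\<lambda>t. x t0 ^ 2 * ((6 * g t * x t + 2 * f t) * ?V t)) has_integral
      2 * integral {t0..T} (\<lambda>t. g t * x t ^ 3 * weight x t)) {t0..T}"
    by (subst has_integral_cong) auto
  then show ?thesis by (simp add: integral_unique flip: integral_mult_right)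
qed

text \<open>
  The two integrands differ by \<open>\<alpha> g x\<^sup>2 e\<^sup>2 + \<beta> g x\<^sup>2 e = (\<alpha> e\<^sup>2 / 2 + \<beta> e)'\<close>, so subtracting a chord does
  not change the integral around the closed curve.
\<close>

lemma weighted_integral_chord:
  assumes x: "solution rhs t0 x" and closed: "x T = x t0" "weight x T = 1"
  shows "integral {t0..T} (\<lambda>t. g t * x t ^ 3 * weight x t)
    = integral {t0..T} (\<lambda>t. g t * x t ^ 2 * weight x t ^ 2 * ((x t - \<beta>) / weight x t - \<alpha>))"
    (is "_ = integral _ ?Q")
proof -
  have "((\<lambda>t. (\<alpha> * weight x t + \<beta>) * (weight x t * (g t * x t ^ 2))) has_integral 0) {t0..T}"
  proof (rule integral_derivative_closed)
    fix t assume t: "t \<in> {t0..T}"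
    show "((\<lambda>t. \<alpha> / 2 * (weight x t * weight x t) + \<beta> * weight x t) has_real_derivative
        (\<alpha> * weight x t + \<beta>) * (weight x t * (g t * x t ^ 2))) (at t within {t0..T})"
      by (rule DERIV_cong[OF DERIV_add[OF DERIV_cmult[OF DERIV_mult[OF weight_deriv[OF x t]
            weight_deriv[OF x t]]] DERIV_cmult[OF weight_deriv[OF x t]]]])
        (simp add: algebra_simps)
  qed (use closed weight_start in auto)
  moreover have "?Q integrable_on {t0..T}"
    using weight_pos[of x]
    by (intro integrable_continuous_real continuous_intros cont_g solution_continuous[OF x]
        continuous_on_weight[OF x]) (auto simp: less_imp_neq[symmetric])
  ultimately have "((\<lambda>t. ?Q t + (\<alpha> * weight x t + \<beta>) * (weight x t * (g t * x t ^ 2)))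
      has_integral integral {t0..T} ?Q) {t0..T}"
    using has_integral_add[OF integrable_integral] by fastforce
  moreover have "?Q t + (\<alpha> * weight x t + \<beta>) * (weight x t * (g t * x t ^ 2))
      = g t * x t ^ 3 * weight x t" for t
    using weight_pos[of x t] by (simp add: field_simps power2_eq_square power3_eq_cube)
  ultimately show ?thesis by (simp add: integral_unique)
qed

text \<open>
  With the chord through the two zeros of \<open>g\<close>, the integrand obtained in \<open>weighted_integral_chord\<close> has
  the constant sign of \<open>\<sigma>\<close>. The chord exists because \<open>e\<close> takes different values at the two zeros.
\<close>

lemma weighted_integral_sign:
  assumes x: "solution rhs t0 x" and closed: "x T = x t0" "weight x T = 1"
    and nz: "\<And>t. t \<in> {t0..T} \<Longrightarrow> x t \<noteq> 0"
    and g: "continuous_on UNIV g"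
    and per: "\<And>t. f (t + 2 * pi) = f t" "\<And>t. g (t + 2 * pi) = g t"
    and zeros: "card {t \<in> {t0..<T}. g t = 0} = 2"
    and mono: "\<And>C. C \<in> components {t. g t \<noteq> 0} \<Longrightarrow> strict_mono_on C (\<lambda>t. \<sigma> * - (f t / g t))"
  shows "\<sigma> * integral {t0..T} (\<lambda>t. g t * x t ^ 3 * weight x t) > 0"
proof -
  obtain z1 z2 where Z: "{t \<in> {t0..<T}. g t = 0} = {z1, z2}" and z12: "z1 < z2"
    using zeros unfolding card_2_iff by (metis insert_commute linorder_neqE)
  have "z1 \<in> {t \<in> {t0..<T}. g t = 0}" "z2 \<in> {t \<in> {t0..<T}. g t = 0}"
    unfolding Z by auto
  then have z: "t0 \<le> z1" "z1 < T" "t0 < z2" "z2 < T" "g z1 = 0" "g z2 = 0"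
    using z12 by auto
  have g_nz: "g t \<noteq> 0" if "t \<in> {t0..<T}" "t \<noteq> z1" "t \<noteq> z2" for t
    using Z that by blast
  have per': "f (t - 2 * pi) = f t" "g (t - 2 * pi) = g t" for t
    using per(1)[of "t - 2 * pi"] per(2)[of "t - 2 * pi"] by simp_all
  have g_nz1: "g t \<noteq> 0" if "t \<in> {z1<..<z2}" for t
    using that z by (intro g_nz) auto
  have g_nz2: "g t \<noteq> 0" if "t \<in> {z2<..<z1 + 2 * pi}" for t
  proof (cases "t < T")
    case True
    then show ?thesis using that z z12 by (intro g_nz) auto
  next
    case False
    then have "g (t - 2 * pi) \<noteq> 0" using that z z12 by (intro g_nz) auto
    then show ?thesis by (simp add: per')
  qed
  have mono_interval: "strict_mono_on {p<..<q} (\<lambda>t. \<sigma> * - (f t / g t))"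
    if "\<And>t. t \<in> {p<..<q} \<Longrightarrow> g t \<noteq> 0" for p q
  proof -
    have "(z1 + z2) / 2 \<in> {t. g t \<noteq> 0}" using g_nz1 z12 by simp
    then have "\<exists>C. C \<in> components {t. g t \<noteq> 0} \<and> {p<..<q} \<subseteq> C"
      using that by (intro exists_component_superset) auto
    then obtain C where "C \<in> components {t. g t \<noteq> 0}" "{p<..<q} \<subseteq> C" by blast
    then show ?thesis using mono monotone_on_subset by blast
  qed

  define e where "e = weight x"
  have e_pos: "e t > 0" for t by (simp add: e_def weight_pos)
  have de: "(e has_real_derivative e t * (g t * x t ^ 2)) (at t within {t0..T})" if "t \<in> {t0..T}" for t
    unfolding e_def by (rule weight_deriv[OF x that])
  have ce: "continuous_on {t0..T} e" and cx: "continuous_on {t0..T} x"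
    unfolding e_def by (rule continuous_on_weight[OF x], rule solution_continuous[OF x])
  have e12: "e z1 \<noteq> e z2"
  proof
    assume eq: "e z1 = e z2"
    have "\<exists>s. z1 < s \<and> s < z2 \<and> (*) (e s * (g s * x s ^ 2)) = (\<lambda>v. 0)"
    proof (rule Rolle_deriv[OF z12 eq])
      show "continuous_on {z1..z2} e" using z by (auto intro: continuous_on_subset[OF ce])
      fix s assume s: "z1 < s" "s < z2"
      then have "(e has_real_derivative e s * (g s * x s ^ 2)) (at s)"
        using de[of s] z by (simp add: at_within_Icc_at)
      then show "(e has_derivative (*) (e s * (g s * x s ^ 2))) (at s)"
        by (simp add: has_field_derivative_def)
    qed
    then obtain s where s: "z1 < s" "s < z2" "e s * (g s * x s ^ 2) = 0"
      by (metis mult_1_right)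
    then show False using e_pos[of s] g_nz1[of s] nz[of s] z by auto
  qed
  \<comment> \<open>In the coordinates \<open>(1 / e, x / e)\<close> the chord through the points at \<open>z1\<close> and \<open>z2\<close> has slope \<open>\<beta>\<close>
    and intercept \<open>\<alpha>\<close>; \<open>h\<close> is the height of the curve above it.\<close>
  define \<beta> where "\<beta> = (x z1 * e z2 - x z2 * e z1) / (e z2 - e z1)"
  define \<alpha> where "\<alpha> = (x z1 - \<beta>) / e z1"
  define h where "h t = (x t - \<beta>) / e t - \<alpha>" for t
  have h1: "h z1 = 0" by (simp add: h_def \<alpha>_def)
  have h2: "h z2 = 0"
  proof -
    have "(x z2 - \<beta>) * e z1 = (x z1 - \<beta>) * e z2"
      using e12 by (simp add: \<beta>_def field_simps)
    then show ?thesis using e_pos[of z1] e_pos[of z2] by (simp add: h_def \<alpha>_def field_simps)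
  qed
  have hT: "h T = h t0" using closed weight_start by (simp add: h_def e_def)
  define \<kappa> where "\<kappa> t = x t ^ 2 / e t" for t
  have \<kappa>: "\<kappa> t > 0" if "t \<in> {t0..T}" for t using nz[OF that] e_pos by (simp add: \<kappa>_def)
  have dh: "(h has_real_derivative \<kappa> t * (f t + \<beta> * g t)) (at t within {t0..T})"
    if t: "t \<in> {t0..T}" for t
    unfolding h_def using e_pos[of t]
    by (intro DERIV_cong[OF DERIV_diff[OF DERIV_divide[OF DERIV_diff[OF solution_deriv[OF x t]
          DERIV_const] de[OF t]] DERIV_const]])
      (auto simp: \<kappa>_def field_simps power2_eq_square power3_eq_cube)
  have ch: "continuous_on {t0..T} h" by (rule DERIV_continuous_on) (rule dh)
  have pos1: "\<sigma> * (g t * h t) > 0" if t: "t \<in> {z1<..<z2}" for t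
  proof (rule sign_between_zeros[OF _ h1 h2 _ _ _ g_nz1 mono_interval[OF g_nz1] t])
    fix s assume s: "s \<in> {z1<..<z2}"
    show "(h has_real_derivative \<kappa> s * (f s + \<beta> * g s)) (at s)"
      using dh[of s] s z by (simp add: at_within_Icc_at)
    show "\<kappa> s > 0" using s z by (intro \<kappa>) auto
  qed (use z in \<open>auto intro: continuous_on_subset[OF ch] continuous_on_subset[OF g]\<close>)

  \<comment> \<open>The second arc runs from \<open>z2\<close> through \<open>T\<close> to \<open>z1 + 2 * pi\<close>.\<close>
  define h' where "h' t = (if t \<le> T then h t else h (t - 2 * pi))" for t
  define \<kappa>' where "\<kappa>' t = (if t \<le> T then \<kappa> t else \<kappa> (t - 2 * pi))" for t
  have dh': "(h' has_real_derivative \<kappa>' t * (f t + \<beta> * g t)) (at t)"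
    if t: "t \<in> {t0<..<t0 + 2 * (2 * pi)}" for t
  proof -
    have "f T = f t0" "g T = g t0" "\<kappa> T = \<kappa> t0"
      using per closed weight_start by (auto simp: \<kappa>_def e_def)
    then have "(h' has_real_derivative (if t \<le> T then \<kappa> t * (f t + \<beta> * g t)
        else \<kappa> (t - 2 * pi) * (f (t - 2 * pi) + \<beta> * g (t - 2 * pi)))) (at t)"
      unfolding h'_def using periodic_concatenation_derivative[OF dh hT _ t] by simp
    then show ?thesis by (simp add: \<kappa>'_def per' split: if_splits)
  qed
  have pos2: "\<sigma> * (g t * h' t) > 0" if t: "t \<in> {z2<..<z1 + 2 * pi}" for t
  proof (rule sign_between_zeros[OF _ _ _ _ _ _ g_nz2 mono_interval[OF g_nz2] t])
    show "h' z2 = 0" using h2 z by (simp add: h'_def)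
    show "h' (z1 + 2 * pi) = 0" using h1 hT z by (auto simp: h'_def)
    show "continuous_on {z2..z1 + 2 * pi} h'"
      by (rule DERIV_atLeastAtMost_imp_continuous_on, rule exI, rule dh') (use z in auto)
    fix s assume s: "s \<in> {z2<..<z1 + 2 * pi}"
    show "(h' has_real_derivative \<kappa>' s * (f s + \<beta> * g s)) (at s)"
      using s z by (intro dh') auto
    show "\<kappa>' s > 0" using s z \<kappa>[of s] \<kappa>[of "s - 2 * pi"] by (auto simp: \<kappa>'_def)
  qed (auto intro: continuous_on_subset[OF g])
  have pos: "\<sigma> * (g t * h t) \<ge> 0" if t: "t \<in> {t0..T}" for t
  proof -
    \<comment> \<open>The last case is not covered by the arcs: if \<open>z1 = t0\<close>, the end \<open>T\<close> of the period is a zero of \<open>g\<close>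
      outside the half-open period.\<close>
    consider "t < z1" | "t = z1 \<or> t = z2 \<or> g t = 0" | "t \<in> {z1<..<z2}" | "z2 < t" "t < z1 + 2 * pi"
      | "t = T" "z1 = t0"
      using t z by fastforce
    then show ?thesis
    proof cases
      case 1
      have "t + 2 * pi \<in> {z2<..<z1 + 2 * pi}" using 1 t z by auto
      from pos2[OF this] show ?thesis using t hT per by (auto simp: h'_def split: if_splits)
    next
      case 2
      then show ?thesis using z by auto
    next
      case 3
      then show ?thesis using pos1 by fastforce
    next
      case 4
      then show ?thesis using pos2[of t] t by (auto simp: h'_def)
    next
      case 5
      then show ?thesis using z per(2)[of t0] by auto
    qed
  qed
  define Q where "Q t = g t * x t ^ 2 * e t ^ 2 * h t" for t
  have Q_eq: "\<sigma> * Q t = (x t ^ 2 * e t ^ 2) * (\<sigma> * (g t * h t))" for t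
    by (simp add: Q_def mult_ac)
  have nonneg: "\<sigma> * Q t \<ge> 0" if "t \<in> {t0..T}" for t
    unfolding Q_eq by (rule mult_nonneg_nonneg[OF _ pos[OF that]]) simp
  have cQ: "continuous_on {t0..T} (\<lambda>t. \<sigma> * Q t)"
    unfolding Q_def by (intro continuous_intros cont_g cx ce ch)
  have mid: "(z1 + z2) / 2 \<in> {t0..T}" "(z1 + z2) / 2 \<in> {z1<..<z2}" using z z12 by auto
  have "\<sigma> * Q ((z1 + z2) / 2) \<noteq> 0"
    unfolding Q_eq using pos1[OF mid(2)] nz[OF mid(1)] e_pos[of "(z1 + z2) / 2"] by auto
  then have "integral {t0..T} (\<lambda>t. \<sigma> * Q t) \<noteq> 0"
    using integral_eq_0_iff[OF cQ _ nonneg] mid(1) by auto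
  moreover have "integral {t0..T} (\<lambda>t. \<sigma> * Q t) \<ge> 0"
    by (intro integral_nonneg integrable_continuous_real cQ nonneg)
  moreover have "integral {t0..T} (\<lambda>t. g t * x t ^ 3 * weight x t) = integral {t0..T} Q"
    unfolding Q_def[abs_def] h_def e_def by (rule weighted_integral_chord[OF x closed])
  ultimately show ?thesis by (simp add: less_le)
qed

end

section \<open>Zeros of order one and two\<close>

lemma zero_of_order_one_or_two:
  fixes d d' d'' :: "real \<Rightarrow> real"
  assumes \<delta>: "\<delta> > 0" and d: "\<And>r. \<bar>r - r0\<bar> < \<delta> \<Longrightarrow> (d has_real_derivative d' r) (at r)"
    and d': "\<And>r. \<bar>r - r0\<bar> < \<delta> \<Longrightarrow> (d' has_real_derivative d'' r) (at r)"
    and zero: "d r0 = 0"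
  shows "d' r0 \<noteq> 0 \<Longrightarrow> has_zero_of_order d r0 1"
    and "d' r0 = 0 \<Longrightarrow> d'' r0 \<noteq> 0 \<Longrightarrow> has_zero_of_order d r0 2"
proof -
  have open_near: "open {r. \<bar>r - r0\<bar> < \<delta>}"
    by (intro open_Collect_less continuous_intros)
  have dd: "(deriv d has_real_derivative d'' r) (at r)" if r: "\<bar>r - r0\<bar> < \<delta>" for r
    by (rule has_field_derivative_transform_within_open[OF d'[OF r] open_near])
      (use r d DERIV_imp_deriv in force)+
  have near: "eventually (\<lambda>r. \<bar>r - r0\<bar> < \<delta>) (nhds r0)"
    using eventually_nhds_in_open[OF open_near, of r0] \<delta> by simp
  have diff: "eventually (\<lambda>r. d differentiable at r) (nhds r0)"
    "eventually (\<lambda>r. deriv d differentiable at r) (nhds r0)"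
    using near d dd by (auto elim!: eventually_mono simp: real_differentiable_def)
  have derivs: "deriv d r0 = d' r0" "deriv (deriv d) r0 = d'' r0"
    using d[of r0] dd[of r0] \<delta> by (auto intro: DERIV_imp_deriv)
  show "has_zero_of_order d r0 1" if "d' r0 \<noteq> 0"
    using that diff derivs zero by (simp add: has_zero_of_order_def)
  show "has_zero_of_order d r0 2" if "d' r0 = 0" "d'' r0 \<noteq> 0"
    using that diff derivs zero
    by (auto simp: has_zero_of_order_def numeral_2_eq_2 less_Suc_eq)
qed

text \<open>
  A double zero with positive second derivative is a strict local minimum: \<open>d'\<close> changes sign from
  negative to positive.
\<close>

lemma degenerate_zero_sides:
  fixes d d' :: "real \<Rightarrow> real"
  assumes "\<delta> > 0" and d: "\<And>r. \<bar>r - r0\<bar> < \<delta> \<Longrightarrow> (d has_real_derivative d' r) (at r)"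
    and zero: "d r0 = 0" "d' r0 = 0" and d': "(d' has_real_derivative l) (at r0)" and l: "l > 0"
  shows "eventually (\<lambda>r. d r > 0) (at_right r0)" "eventually (\<lambda>r. d r > 0) (at_left r0)"
proof -
  obtain \<mu> where \<mu>: "\<mu> > 0" "\<And>h. 0 < h \<Longrightarrow> h < \<mu> \<Longrightarrow> d' (r0 + h) > 0"
    using DERIV_pos_inc_right[OF d' l] zero by auto
  obtain \<nu> where \<nu>: "\<nu> > 0" "\<And>h. 0 < h \<Longrightarrow> h < \<nu> \<Longrightarrow> d' (r0 - h) < 0"
    using DERIV_pos_inc_left[OF d' l] zero by auto
  have "d r > 0" if r: "r0 < r" "r < r0 + min \<delta> \<mu>" for r
  proof -
    have "d r0 < d r"
    proof (rule DERIV_pos_imp_increasing_open[OF r(1)])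
      fix s assume "r0 < s" "s < r"
      then show "\<exists>y. (d has_real_derivative y) (at s) \<and> y > 0"
        using r \<mu>(2)[of "s - r0"] by (intro exI[of _ "d' s"] conjI d) auto
    next
      show "continuous_on {r0..r} d"
        by (rule DERIV_atLeastAtMost_imp_continuous_on) (use r d in force)
    qed
    then show ?thesis using zero by simp
  qed
  then show "eventually (\<lambda>r. d r > 0) (at_right r0)"
    unfolding eventually_at_right_field using \<mu>(1) \<open>\<delta> > 0\<close> by (intro exI[of _ "r0 + min \<delta> \<mu>"]) auto
  have "d r > 0" if r: "r < r0" "r0 - min \<delta> \<nu> < r" for r
  proof -
    have "d r > d r0"
    proof (rule DERIV_neg_imp_decreasing_open[OF r(1)])
      fix s assume "r < s" "s < r0"
      then show "\<exists>y. (d has_real_derivative y) (at s) \<and> y < 0"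
        using r \<nu>(2)[of "r0 - s"] by (intro exI[of _ "d' s"] conjI d) auto
    next
      show "continuous_on {r..r0} d"
        by (rule DERIV_atLeastAtMost_imp_continuous_on) (use r d in force)
    qed
    then show ?thesis using zero by simp
  qed
  then show "eventually (\<lambda>r. d r > 0) (at_left r0)"
    unfolding eventually_at_left_field using \<nu>(1) \<open>\<delta> > 0\<close> by (intro exI[of _ "r0 - min \<delta> \<nu>"]) auto
qed

section \<open>Multiplicity and stability of limit cycles\<close>

theorem theorem3p1:
  fixes f g u :: "real \<Rightarrow> real" and F :: "real \<Rightarrow> real \<Rightarrow> real"
    and t0 :: real and x :: "real \<Rightarrow> real"
  assumes "smooth f" and "smooth g"
    and "\<forall>t. f (t + 2 * pi) = f t" and "\<forall>t. g (t + 2 * pi) = g t"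
    and "\<not> (\<exists>t. f t = 0 \<and> g t = 0)"
    and "\<forall>a. card {t \<in> {a..<a + 2 * pi}. g t = 0} = 2"
    and "u = (\<lambda>t. - (f t / g t))"
    and "(\<forall>C\<in>components {t. g t \<noteq> 0}. strict_mono_on C u) \<or>
         (\<forall>C\<in>components {t. g t \<noteq> 0}. strict_antimono_on C u)"
    and "F = (\<lambda>t y. g t * y ^ 3 + f t * y ^ 2)"
    and "limit_cycle F t0 x"
    and "\<forall>t\<in>{t0..t0 + 2 * pi}. x t \<noteq> 0"
  shows "(\<exists>k\<le>2. has_multiplicity F t0 x k) \<and>
    (\<not> hyperbolic F t0 x \<longrightarrow>
      ((\<forall>C\<in>components {t. g t \<noteq> 0}. strict_mono_on C u) \<longrightarrow>
         lower_stable F t0 x \<and> upper_unstable F t0 x) \<and>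
      ((\<forall>C\<in>components {t. g t \<noteq> 0}. strict_antimono_on C u) \<longrightarrow>
         lower_unstable F t0 x \<and> upper_stable F t0 x))"
proof -
  have "continuous_on UNIV h" if "smooth h" for h
  proof -
    have "(deriv ^^ 0) h differentiable at t" for t
      using that unfolding smooth_def by blast
    then show ?thesis
      by (simp add: continuous_at_imp_continuous_on differentiable_imp_continuous_within)
  qed
  then have cont: "continuous_on UNIV f" "continuous_on UNIV g" using assms(1,2) by blast+
  interpret abel_equation f g t0
    by unfold_locales (auto intro: continuous_on_subset cont)
  have x: "solution rhs t0 x" and closed: "x T = x t0"
    using assms(9,10) by (auto simp: limit_cycle_def periodic_solution_def)
  have T: "t0 \<in> {t0..T}" "T \<in> {t0..T}" by auto
  obtain \<delta> L1 L2 where \<delta>: "\<delta> > 0"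
    and L1: "\<And>r. \<bar>r - x t0\<bar> < \<delta> \<Longrightarrow> (poincare F t0 has_real_derivative L1 r) (at r)"
    and L2: "\<And>r. \<bar>r - x t0\<bar> < \<delta> \<Longrightarrow> (L1 has_real_derivative L2 r) (at r)"
    and L1x: "L1 (x t0) = exp (integral {t0..T} (\<lambda>t. 3 * g t * x t ^ 2 + 2 * f t * x t))"
    and L2x: "L2 (x t0) = L1 (x t0) * integral {t0..T} (\<lambda>t. (6 * g t * x t + 2 * f t) *
        exp (integral {t0..t} (\<lambda>s. 3 * g s * x s ^ 2 + 2 * f s * x s)))"
    by (rule poincare_twice_differentiable[OF x, folded assms(9)]) (rule that; assumption)
  have x0: "x t0 \<noteq> 0" using assms(11) T by blast
  define d where "d r = poincare F t0 r - r" for r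
  have d0: "d (x t0) = 0"
    using poincare_solution[OF x] closed assms(9) by (simp add: d_def)
  have dd: "(d has_real_derivative L1 r - 1) (at r)" if "\<bar>r - x t0\<bar> < \<delta>" for r
    unfolding d_def by (intro DERIV_diff L1 that DERIV_ident)
  have dd': "((\<lambda>r. L1 r - 1) has_real_derivative L2 r) (at r)" if "\<bar>r - x t0\<bar> < \<delta>" for r
    using DERIV_diff[OF L2[OF that] DERIV_const[of 1]] by simp
  have weightT: "weight x T = L1 (x t0)"
    using first_variation_weight[OF x T(2)] x0 closed by (simp add: L1x)
  have hyp: "hyperbolic F t0 x \<longleftrightarrow> L1 (x t0) \<noteq> 1"
    unfolding hyperbolic_def using DERIV_imp_deriv[OF L1, of "x t0"] \<delta> by simp
  \<comment> \<open>Here \<open>\<sigma> = 1\<close> serves increasing \<open>u\<close> and \<open>\<sigma> = -1\<close> decreasing \<open>u\<close>.\<close>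
  have sign: "\<sigma> * L2 (x t0) > 0"
    if "L1 (x t0) = 1" "\<And>C. C \<in> components {t. g t \<noteq> 0} \<Longrightarrow> strict_mono_on C (\<lambda>t. \<sigma> * - (f t / g t))"
    for \<sigma>
  proof -
    have w: "weight x T = 1" using weightT that(1) by simp
    have "0 < \<sigma> * integral {t0..T} (\<lambda>t. g t * x t ^ 3 * weight x t)"
      using assms(3,4,6,11) cont(2) by (intro weighted_integral_sign x closed w that(2)) auto
    also have "\<dots> = x t0 ^ 2 / 2 * (\<sigma> * L2 (x t0))"
      using second_variation_weight[OF x closed w] that(1) by (simp add: L2x)
    finally show ?thesis using x0 by (simp add: zero_less_mult_iff)
  qed
  have increasing: "L2 (x t0) > 0"
    if "L1 (x t0) = 1" "\<forall>C\<in>components {t. g t \<noteq> 0}. strict_mono_on C u"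
    using sign[of 1] that assms(7) by simp
  have decreasing: "L2 (x t0) < 0"
    if "L1 (x t0) = 1" "\<forall>C\<in>components {t. g t \<noteq> 0}. strict_antimono_on C u"
    using sign[of "-1"] that assms(7) by (force simp: monotone_on_def)
  have "\<exists>k\<le>2. has_multiplicity F t0 x k"
  proof (cases "L1 (x t0) = 1")
    case True
    then have "L2 (x t0) \<noteq> 0" using assms(8) increasing decreasing by fastforce
    then have "has_multiplicity F t0 x 2"
      unfolding has_multiplicity_def d_def[symmetric]
      using True by (intro zero_of_order_one_or_two(2)[OF \<delta> dd dd' d0]) auto
    then show ?thesis by blast
  next
    case False
    then have "has_multiplicity F t0 x 1"
      unfolding has_multiplicity_def d_def[symmetric]
      by (intro zero_of_order_one_or_two(1)[OF \<delta> dd dd' d0]) auto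
    then show ?thesis by (intro exI[of _ 1]) simp
  qed
  moreover have "lower_stable F t0 x \<and> upper_unstable F t0 x"
    if "L1 (x t0) = 1" "\<forall>C\<in>components {t. g t \<noteq> 0}. strict_mono_on C u"
    using degenerate_zero_sides[OF \<delta> dd d0 _ dd'[of "x t0"]] increasing[OF that] that(1) \<delta>
    by (simp add: lower_stable_def upper_unstable_def d_def)
  moreover have "lower_unstable F t0 x \<and> upper_stable F t0 x"
    if "L1 (x t0) = 1" "\<forall>C\<in>components {t. g t \<noteq> 0}. strict_antimono_on C u"
  proof -
    have "((\<lambda>r. - d r) has_real_derivative - (L1 r - 1)) (at r)" if "\<bar>r - x t0\<bar> < \<delta>" for r
      by (rule DERIV_minus[OF dd[OF that]])
    moreover have "((\<lambda>r. - (L1 r - 1)) has_real_derivative - L2 (x t0)) (at (x t0))"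
      by (rule DERIV_minus[OF dd']) (use \<delta> in simp)
    ultimately show ?thesis
      using degenerate_zero_sides[OF \<delta>, of "x t0" "\<lambda>r. - d r" "\<lambda>r. - (L1 r - 1)" "- L2 (x t0)"]
        decreasing[OF that] that(1) d0
      by (simp add: lower_unstable_def upper_stable_def d_def)
  qed
  ultimately show ?thesis using hyp by blast
qed

end
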